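(* Let $0<\delta<\frac{\pi}{4}$, $v>0$, $m>0$, $g=9.81$, and put $\mu=\tan(\delta)$, $a=\frac{g}{v^2\sin\delta}$, and let $F$ be the constant force $F(t)=(0,-mg)$. Let $\alpha_\delta=(x_\delta,y_\delta)$, $s_0$, and the ramps $(\gamma_\delta,n_\delta)$ and $(\tilde\gamma_\delta,\tilde n_\delta)$ on $[0,\infty)$ be those defined in the context from $a$ and $\delta$. Then: (a) For the ramp $(\gamma_\delta,n_\delta)$, $$\beta(t)=\gamma_\delta(vt)\quad\text{and}\quad \lambda(t)=mg\cot(\delta)\,y_\delta'(s_0-vt),\qquad t\ge 0,$$ is a solution of the ramp with external force $(\gamma_\delta,n_\delta,F)$ and kinetic coefficient of friction $\tan(\delta)$. (b) For the ramp $(\tilde\gamma_\delta,\tilde n_\delta)$, $$\beta(t)=\tilde\gamma_\delta(vt)\quad\text{and}\quad \lambda(t)=-mg\cot(\delta)\,y_\delta'(s_0+vt),\qquad t\ge 0,$$ is a solution of the ramp with external force $(\tilde\gamma_\delta,\tilde n_\delta,F)$ and kinetic coefficient of friction $\tan(\delta)$. (c) In both cases $|\beta'(t)|=v$ for all $t\ge0$, so these motions have constant speed.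
   Context: A ramp in $\mathbb{R}^2$ is a pair $(\gamma,n)$ where $\gamma$ is a regular curve ($\gamma'$ never vanishes) defined on an interval $J$ and $n:J\to\mathbb{R}^2$ is a normal of $\gamma$, i.e. $|n(t)|=1$ and $n(t)\cdot\gamma'(t)=0$ for all $t$. A ramp with external force is a triple $(\gamma,n,F)$ with $(\gamma,n)$ a ramp and $F:J\to\mathbb{R}^2$ smooth. Given $0<\mu<1$ and $m>0$, a solution of the ramp with external force $(\gamma,n,F)$ and kinetic coefficient of friction $\mu$ is a curve of the form $\beta(t)=\gamma(h(t))$ together with a nonnegative real function $\lambda$ such that for all $t$ $$F(h(t))+\lambda(t)\,n(h(t))-\mu\,\lambda(t)\,\frac{\beta'(t)}{|\beta'(t)|}=m\,\beta''(t).$$ In the theorem, $J=[0,\infty)$ and $h(t)=vt$. For $a>0$ and $0<\delta<\frac{\pi}{2}$, let $$\alpha(s)=(x(s),y(s))=\left(s+\frac1a\ln(1+e^{-2as}),\ \frac2a\,\mathrm{arccot}(e^{-as})\right),\quad s\in\mathbb{R},$$ where $\mathrm{arccot}(u)\in(0,\frac{\pi}{2})$ for $u>0$, and let $$\alpha_\delta(s)=(x_\delta(s),y_\delta(s))=\left(\cos(\delta)x(s)+\sin(\delta)y(s),\ -\sin(\delta)x(s)+\cos(\delta)y(s)\right).$$ Put $s_0=\frac{\mathrm{arcsinh}(\cot\delta)}{a}$. For $s\in[0,\infty)$ define $$\gamma_\delta(s)=\alpha_\delta(s_0-s),\qquad n_\delta(s)=(y_\delta'(s_0-s),-x_\delta'(s_0-s)),$$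 $$\tilde\gamma_\delta(s)=\alpha_\delta(s_0+s),\qquad \tilde n_\delta(s)=(-y_\delta'(s_0+s),x_\delta'(s_0+s)),$$ where $x_\delta'$, $y_\delta'$ denote the derivatives of $x_\delta,y_\delta$ evaluated at the indicated points. *)

theory Defs
  imports "HOL-Analysis.Analysis"
begin

text \<open>Derivative of a curve on a set. All uses are on nondegenerate intervals, where
  it is unique; at an endpoint belonging to the interval it is the one-sided derivative.\<close>

definition D_on :: "real set \<Rightarrow> (real \<Rightarrow> 'a::real_normed_vector) \<Rightarrow> real \<Rightarrow> 'a" where
  "D_on J f = (\<lambda>t. vector_derivative f (at t within J))"

definition smooth_on :: "real set \<Rightarrow> (real \<Rightarrow> 'a::real_normed_vector) \<Rightarrow> bool" where
  "smooth_on J f \<longleftrightarrow> (\<forall>k. ((D_on J ^^ k) f) differentiable_on J)"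

text \<open>The plane is \<open>real \<times> real\<close>, whose library norm and inner product are the Euclidean
  ones.\<close>

definition curve :: "real set \<Rightarrow> (real \<Rightarrow> real \<times> real) \<Rightarrow> bool" where
  "curve J \<gamma> \<longleftrightarrow> is_interval J \<and> interior J \<noteq> {} \<and> smooth_on J \<gamma>"

definition regular_curve :: "real set \<Rightarrow> (real \<Rightarrow> real \<times> real) \<Rightarrow> bool" where
  "regular_curve J \<gamma> \<longleftrightarrow> curve J \<gamma> \<and> (\<forall>t\<in>J. D_on J \<gamma> t \<noteq> 0)"

definition ramp :: "real set \<Rightarrow> (real \<Rightarrow> real \<times> real) \<Rightarrow> (real \<Rightarrow> real \<times> real) \<Rightarrow> bool" where
  "ramp J \<gamma> n \<longleftrightarrow> regular_curve J \<gamma> \<and> (\<forall>t\<in>J. norm (n t) = 1 \<and> n t \<bullet> D_on J \<gamma> t = 0)"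

definition ramp_with_force ::
  "real set \<Rightarrow> (real \<Rightarrow> real \<times> real) \<Rightarrow> (real \<Rightarrow> real \<times> real) \<Rightarrow> (real \<Rightarrow> real \<times> real) \<Rightarrow> bool" where
  "ramp_with_force J \<gamma> n F \<longleftrightarrow> ramp J \<gamma> n \<and> smooth_on J F"

text \<open>Time runs over \<open>I\<close>, and \<open>lam\<close> is the magnitude of the normal force. The condition
  \<open>D_on I \<beta> t \<noteq> 0\<close> is implicit in the quotient in the equation of motion.\<close>

definition ramp_solution ::
  "real \<Rightarrow> real \<Rightarrow> real set \<Rightarrow> (real \<Rightarrow> real \<times> real) \<Rightarrow> (real \<Rightarrow> real \<times> real) \<Rightarrow> (real \<Rightarrow> real \<times> real)
    \<Rightarrow> real set \<Rightarrow> (real \<Rightarrow> real) \<Rightarrow> (real \<Rightarrow> real \<times> real) \<Rightarrow> (real \<Rightarrow> real) \<Rightarrow> bool" where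
  "ramp_solution m \<mu> J \<gamma> n F I h \<beta> lam \<longleftrightarrow>
     0 < m \<and> 0 < \<mu> \<and> \<mu> < 1 \<and> ramp_with_force J \<gamma> n F \<and> curve I \<beta> \<and>
     (\<forall>t\<in>I. h t \<in> J \<and> \<beta> t = \<gamma> (h t) \<and> 0 \<le> lam t \<and> D_on I \<beta> t \<noteq> 0 \<and>
        F (h t) + lam t *\<^sub>R n (h t)
          - (\<mu> * lam t) *\<^sub>R (D_on I \<beta> t /\<^sub>R norm (D_on I \<beta> t))
        = m *\<^sub>R D_on I (D_on I \<beta>) t)"

text \<open>Only meaningful for \<open>u > 0\<close>.\<close>

definition arccot :: "real \<Rightarrow> real" where
  "arccot u = (THE \<theta>. 0 < \<theta> \<and> \<theta> < pi / 2 \<and> cot \<theta> = u)"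

definition x_alpha :: "real \<Rightarrow> real \<Rightarrow> real" where
  "x_alpha a s = s + 1 / a * ln (1 + exp (- 2 * a * s))"

definition y_alpha :: "real \<Rightarrow> real \<Rightarrow> real" where
  "y_alpha a s = 2 / a * arccot (exp (- a * s))"

definition x_delta :: "real \<Rightarrow> real \<Rightarrow> real \<Rightarrow> real" where
  "x_delta a \<delta> s = cos \<delta> * x_alpha a s + sin \<delta> * y_alpha a s"

definition y_delta :: "real \<Rightarrow> real \<Rightarrow> real \<Rightarrow> real" where
  "y_delta a \<delta> s = - sin \<delta> * x_alpha a s + cos \<delta> * y_alpha a s"

definition alpha_delta :: "real \<Rightarrow> real \<Rightarrow> real \<Rightarrow> real \<times> real" where
  "alpha_delta a \<delta> s = (x_delta a \<delta> s, y_delta a \<delta> s)"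

definition s_zero :: "real \<Rightarrow> real \<Rightarrow> real" where
  "s_zero a \<delta> = arsinh (cot \<delta>) / a"

definition gamma_delta :: "real \<Rightarrow> real \<Rightarrow> real \<Rightarrow> real \<times> real" where
  "gamma_delta a \<delta> s = alpha_delta a \<delta> (s_zero a \<delta> - s)"

definition n_delta :: "real \<Rightarrow> real \<Rightarrow> real \<Rightarrow> real \<times> real" where
  "n_delta a \<delta> s =
     (deriv (y_delta a \<delta>) (s_zero a \<delta> - s), - deriv (x_delta a \<delta>) (s_zero a \<delta> - s))"

definition gamma_tilde :: "real \<Rightarrow> real \<Rightarrow> real \<Rightarrow> real \<times> real" where
  "gamma_tilde a \<delta> s = alpha_delta a \<delta> (s_zero a \<delta> + s)"

definition n_tilde :: "real \<Rightarrow> real \<Rightarrow> real \<Rightarrow> real \<times> real" where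
  "n_tilde a \<delta> s =
     (- deriv (y_delta a \<delta>) (s_zero a \<delta> + s), deriv (x_delta a \<delta>) (s_zero a \<delta> + s))"

end

theory Submission
  imports Defs
begin

text \<open>
  The curve \<open>\<alpha>\<close> has velocity \<open>(tanh (a s), sech (a s))\<close>, a unit vector, so every motion
  \<open>t \<mapsto> \<alpha>\<^sub>\<delta> (s\<^sub>0 \<plusminus> v t)\<close> has constant speed \<open>v\<close>. Writing \<open>(X, Y)\<close> for the velocity of \<open>\<alpha>\<^sub>\<delta>\<close> and
  \<open>S = sech (a s) = sin \<delta> X + cos \<delta> Y\<close>, its acceleration is \<open>a S (Y, - X)\<close>; with
  \<open>v\<^sup>2 a = g / sin \<delta>\<close> the equation of motion reduces to \<open>X\<^sup>2 + Y\<^sup>2 = 1\<close>. The normal force is nonnegative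
  because \<open>Y = S (cos \<delta> - sin \<delta> sinh (a s))\<close> changes sign exactly at \<open>s\<^sub>0\<close>.
\<close>

section \<open>Derivatives and smoothness on a subset of the line\<close>

lemma D_on_eqI:
  assumes "(f has_vector_derivative d) (at t within J)" "at t within J \<noteq> bot"
  shows "D_on J f t = d"
  using assms unfolding D_on_def by (intro vector_derivative_within)

text \<open>Points just to the right of \<open>t\<close> stay in the ray, so the derivative within
  the ray is unique even at the endpoint \<open>b\<close>.\<close>

lemma at_within_atLeast_neq_bot:
  fixes t b :: real
  assumes "b \<le> t"
  shows "at t within {b..} \<noteq> bot"
proof -
  have "at_right t \<le> at t within {b..}"
    using assms by (intro at_le) auto
  then show ?thesis
    using trivial_limit_at_right_real[of t] by (metis bot_unique)
qed

text \<open>Membership in \<open>P\<close> acts as an invariant of differentiation, so smoothness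
  follows without a formula for the higher derivatives.\<close>

lemma smooth_on_coinduct:
  assumes "P f" and nontrivial: "\<And>t. t \<in> J \<Longrightarrow> at t within J \<noteq> bot"
    and step: "\<And>f. P f \<Longrightarrow> \<exists>f'. P f' \<and> (\<forall>t\<in>J. (f has_vector_derivative f' t) (at t within J))"
  shows "smooth_on J f"
proof -
  have transfer: "(D has_vector_derivative g' t) (at t within J)"
    if "\<forall>t\<in>J. D t = g t" "\<forall>t\<in>J. (g has_vector_derivative g' t) (at t within J)" "t \<in> J"
    for D g g' t
    using that by (blast intro: has_vector_derivative_transform[OF \<open>t \<in> J\<close>, of D g])
  \<comment> \<open>Only agreement on \<open>J\<close> is claimed: off \<open>J\<close> the values
    of \<open>D_on J\<close> are not controlled, so the iterates themselves need not satisfy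
    \<open>P\<close>.\<close>
  have *: "\<exists>g. P g \<and> (\<forall>t\<in>J. (D_on J ^^ k) f t = g t)" for k
  proof (induction k)
    case 0
    then show ?case using \<open>P f\<close> by auto
  next
    case (Suc k)
    then obtain g where g: "P g" "\<forall>t\<in>J. (D_on J ^^ k) f t = g t" by blast
    obtain g' where g': "P g'" "\<forall>t\<in>J. (g has_vector_derivative g' t) (at t within J)"
      using step[OF g(1)] by blast
    have "(D_on J ^^ Suc k) f t = g' t" if "t \<in> J" for t
      using D_on_eqI[OF transfer[OF g(2) g'(2) that] nontrivial[OF that]] by simp
    then show ?case using g'(1) by blast
  qed
  have "(D_on J ^^ k) f differentiable (at t within J)" if "t \<in> J" for k t
    using *[of k] step transfer that by (metis differentiableI_vector)
  then show ?thesis unfolding smooth_on_def differentiable_on_def by blast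
qed

lemma smooth_on_const:
  assumes "\<And>t. t \<in> J \<Longrightarrow> at t within J \<noteq> bot"
  shows "smooth_on J (\<lambda>t. c)"
  by (rule smooth_on_coinduct[where P = "\<lambda>f. \<exists>c. f = (\<lambda>t. c)"])
    (use assms in \<open>auto intro!: exI[of _ "\<lambda>t. 0"] derivative_eq_intros\<close>)

section \<open>Derivatives of the unrotated curve\<close>

text \<open>Trades the definite description for \<open>arctan\<close>, which can be differentiated;
  existence and uniqueness both come from passing to the complementary angle.\<close>

lemma arccot_eq_arctan:
  assumes "0 < u"
  shows "arccot u = pi / 2 - arctan u"
proof -
  have "0 < arctan u" "arctan u < pi / 2"
    using assms arctan_ubound by simp_all
  moreover have "cot (pi / 2 - arctan u) = u"
    using tan_arctan[of u] by (simp add: cot_def sin_diff cos_diff tan_def)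
  moreover have "\<theta> = pi / 2 - arctan (cot \<theta>)" if "0 < \<theta>" "\<theta> < pi / 2" for \<theta>
  proof -
    have "tan (pi / 2 - \<theta>) = cot \<theta>"
      by (simp add: cot_def tan_def sin_diff cos_diff)
    then have "arctan (cot \<theta>) = pi / 2 - \<theta>"
      using that by (intro arctan_unique) auto
    then show ?thesis by simp
  qed
  ultimately show ?thesis
    unfolding arccot_def by (intro the_equality) auto
qed

context
  fixes a :: real
  assumes a_pos: "0 < a"
begin

text \<open>The right-hand side is what the chain rule produces from the logarithm in
  \<open>x_alpha\<close>.\<close>

lemma tanh_conv_exp: "tanh (a * s) = 1 - 2 * exp (- 2 * a * s) / (1 + exp (- 2 * a * s))"
proof -
  have "1 + exp (- 2 * a * s) \<noteq> 0" by (smt (verit) exp_gt_zero)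
  then show ?thesis by (simp add: tanh_real_altdef field_simps)
qed

text \<open>The square stays unexpanded because the derivative of \<open>arctan\<close> yields the
  denominator in this shape.\<close>

lemma inverse_cosh_conv_exp:
  "inverse (cosh (a * s)) = 2 * exp (- a * s) / (1 + exp (- a * s) ^ 2)"
proof -
  have "1 + exp (- a * s) ^ 2 \<noteq> 0" by (smt (verit) zero_le_power2)
  then show ?thesis
    by (simp add: cosh_def field_simps exp_minus power2_eq_square)
qed

lemma x_alpha_has_derivative: "(x_alpha a has_real_derivative tanh (a * s)) (at s)"
proof -
  have "0 < 1 + exp (- 2 * a * s)" by (smt (verit) exp_gt_zero)
  then show ?thesis
    unfolding x_alpha_def[abs_def] tanh_conv_exp using a_pos
    by - ((rule derivative_eq_intros refl | assumption)+, simp add: divide_simps)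
qed

lemma y_alpha_has_derivative: "(y_alpha a has_real_derivative inverse (cosh (a * s))) (at s)"
proof -
  have "1 + exp (- a * s) ^ 2 \<noteq> 0" by (smt (verit) zero_le_power2)
  moreover have "y_alpha a = (\<lambda>s. 2 / a * (pi / 2 - arctan (exp (- a * s))))"
    by (simp add: fun_eq_iff y_alpha_def arccot_eq_arctan)
  ultimately show ?thesis
    unfolding inverse_cosh_conv_exp using a_pos
    by - (simp only:, (rule derivative_eq_intros refl | assumption)+, simp add: divide_simps)
qed

lemma tanh_square_plus_sech_square: "tanh (a * s) ^ 2 + inverse (cosh (a * s)) ^ 2 = 1"
proof -
  have "tanh (a * s) ^ 2 + inverse (cosh (a * s)) ^ 2
      = (sinh (a * s) ^ 2 + 1) / cosh (a * s) ^ 2"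
    by (simp add: tanh_def power_divide inverse_eq_divide add_divide_distrib)
  also have "\<dots> = 1"
    unfolding cosh_square_eq[symmetric] by simp
  finally show ?thesis .
qed

lemma tanh_has_derivative:
  "((\<lambda>s. tanh (a * s)) has_real_derivative a * inverse (cosh (a * s)) ^ 2) (at s)"
proof -
  have "inverse (cosh (a * s)) ^ 2 = 1 - tanh (a * s) ^ 2"
    using tanh_square_plus_sech_square[of s] by simp
  then show ?thesis
    by (auto intro!: derivative_eq_intros)
qed

lemma inverse_cosh_has_derivative:
  "((\<lambda>s. inverse (cosh (a * s))) has_real_derivative
     - a * (inverse (cosh (a * s)) * tanh (a * s))) (at s)"
  by (auto intro!: derivative_eq_intros simp: tanh_def field_simps)

section \<open>Smoothness through an algebra closed under differentiation\<close>

text \<open>Serves as the invariant for \<open>smooth_on_coinduct\<close>. Differentiating the two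
  coordinates gives tanh and sech, whose own derivatives are polynomials in tanh and sech, so these
  generators suffice.\<close>

inductive alpha_alg :: "(real \<Rightarrow> real) \<Rightarrow> bool" where
  const: "alpha_alg (\<lambda>s. c)"
| x_alpha: "alpha_alg (x_alpha a)"
| y_alpha: "alpha_alg (y_alpha a)"
| tanh: "alpha_alg (\<lambda>s. tanh (a * s))"
| sech: "alpha_alg (\<lambda>s. inverse (cosh (a * s)))"
| add: "alpha_alg f \<Longrightarrow> alpha_alg g \<Longrightarrow> alpha_alg (\<lambda>s. f s + g s)"
| mult: "alpha_alg f \<Longrightarrow> alpha_alg g \<Longrightarrow> alpha_alg (\<lambda>s. f s * g s)"

lemma alpha_alg_derivative:
  assumes "alpha_alg f"
  shows "\<exists>f'. alpha_alg f' \<and> (\<forall>s. (f has_real_derivative f' s) (at s))"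
  using assms
proof induction
  case (const c)
  show ?case
    by (intro exI[of _ "\<lambda>s. 0"]) (auto intro: alpha_alg.const)
next
  case x_alpha
  show ?case using alpha_alg.tanh x_alpha_has_derivative by blast
next
  case y_alpha
  show ?case using alpha_alg.sech y_alpha_has_derivative by blast
next
  case tanh
  show ?case
    \<comment> \<open>The derivative a sech^2 is spelled as a product so that the closure rule
      \<open>mult\<close> applies.\<close>
    by (intro exI[of _ "\<lambda>s. a * (inverse (cosh (a * s)) * inverse (cosh (a * s)))"])
      (use tanh_has_derivative in
        \<open>auto simp: power2_eq_square intro!: alpha_alg.intros(1,5,7)\<close>)
next
  case sech
  show ?case
    by (intro exI[of _ "\<lambda>s. - a * (inverse (cosh (a * s)) * tanh (a * s))"] conjI allI
        inverse_cosh_has_derivative alpha_alg.mult alpha_alg.const alpha_alg.tanh alpha_alg.sech)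
next
  case (add f g)
  then obtain f' g' where "alpha_alg f'" "alpha_alg g'"
    "\<forall>s. (f has_real_derivative f' s) (at s)" "\<forall>s. (g has_real_derivative g' s) (at s)" by blast
  then show ?case
    by (intro exI[of _ "\<lambda>s. f' s + g' s"]) (auto intro!: alpha_alg.add DERIV_add)
next
  case (mult f g)
  then obtain f' g' where "alpha_alg f'" "alpha_alg g'"
    "\<forall>s. (f has_real_derivative f' s) (at s)" "\<forall>s. (g has_real_derivative g' s) (at s)" by blast
  with mult show ?case
    by (intro exI[of _ "\<lambda>s. f' s * g s + g' s * f s"])
      (auto intro!: alpha_alg.add alpha_alg.mult DERIV_mult)
qed

text \<open>The affine parameter covers both ramps (\<open>c\<close> = -1 or 1) and the motions
  along them (\<open>c\<close> = -v or v), with \<open>b\<close> the starting parameter.\<close>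

lemma has_vector_derivative_affine_pair:
  assumes "\<And>s. (u has_real_derivative u' s) (at s)" "\<And>s. (w has_real_derivative w' s) (at s)"
  shows "((\<lambda>t. (u (b + c * t), w (b + c * t))) has_vector_derivative
           (c * u' (b + c * t), c * w' (b + c * t))) (at t within J)"
proof -
  have "((\<lambda>t. f (b + c * t)) has_vector_derivative c * f' (b + c * t)) (at t within J)"
    if "\<And>s. (f has_real_derivative f' s) (at s)" for f f'
  proof -
    have "((\<lambda>t. b + c * t) has_real_derivative c) (at t within J)"
      by (auto intro!: derivative_eq_intros)
    from DERIV_chain'[OF this that] show ?thesis
      by (simp add: has_real_derivative_iff_has_vector_derivative mult.commute)
  qed
  then show ?thesis using assms by (intro has_vector_derivative_Pair) auto
qed

lemma smooth_on_alpha_alg: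
  assumes "alpha_alg u" "alpha_alg w" and "\<And>t. t \<in> J \<Longrightarrow> at t within J \<noteq> bot"
  shows "smooth_on J (\<lambda>t. (u (b + c * t), w (b + c * t)))"
proof (rule smooth_on_coinduct[where
      P = "\<lambda>f. \<exists>u w. alpha_alg u \<and> alpha_alg w \<and> f = (\<lambda>t. (u (b + c * t), w (b + c * t)))"])
  fix f assume "\<exists>u w. alpha_alg u \<and> alpha_alg w \<and> f = (\<lambda>t. (u (b + c * t), w (b + c * t)))"
  then obtain u w where uw: "alpha_alg u" "alpha_alg w"
    and f: "f = (\<lambda>t. (u (b + c * t), w (b + c * t)))" by blast
  obtain u' w' where alg: "alpha_alg u'" "alpha_alg w'"
    and deriv: "\<And>s. (u has_real_derivative u' s) (at s)" "\<And>s. (w has_real_derivative w' s) (at s)"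
    using alpha_alg_derivative[OF uw(1)] alpha_alg_derivative[OF uw(2)] by blast
  have "alpha_alg (\<lambda>s. c * u' s)" "alpha_alg (\<lambda>s. c * w' s)"
    using alg by (auto intro: alpha_alg.mult alpha_alg.const)
  moreover have "\<forall>t\<in>J. (f has_vector_derivative (c * u' (b + c * t), c * w' (b + c * t)))
      (at t within J)"
    unfolding f using has_vector_derivative_affine_pair[OF deriv] by blast
  ultimately show "\<exists>f'. (\<exists>u w. alpha_alg u \<and> alpha_alg w \<and>
      f' = (\<lambda>t. (u (b + c * t), w (b + c * t)))) \<and>
      (\<forall>t\<in>J. (f has_vector_derivative f' t) (at t within J))"
    by (intro exI[of _ "\<lambda>t. (c * u' (b + c * t), c * w' (b + c * t))"]) blast
qed (use assms in blast)+

section \<open>Velocity and acceleration of the rotated curve\<close>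

definition vel_x :: "real \<Rightarrow> real \<Rightarrow> real" where
  "vel_x \<delta> s = cos \<delta> * tanh (a * s) + sin \<delta> * inverse (cosh (a * s))"

definition vel_y :: "real \<Rightarrow> real \<Rightarrow> real" where
  "vel_y \<delta> s = - sin \<delta> * tanh (a * s) + cos \<delta> * inverse (cosh (a * s))"

lemma x_delta_has_derivative: "(x_delta a \<delta> has_real_derivative vel_x \<delta> s) (at s)"
  unfolding x_delta_def[abs_def] vel_x_def
  by (auto intro!: derivative_eq_intros x_alpha_has_derivative y_alpha_has_derivative)

lemma y_delta_has_derivative: "(y_delta a \<delta> has_real_derivative vel_y \<delta> s) (at s)"
  unfolding y_delta_def[abs_def] vel_y_def
  by (auto intro!: derivative_eq_intros x_alpha_has_derivative y_alpha_has_derivative)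

lemma deriv_x_delta: "deriv (x_delta a \<delta>) = vel_x \<delta>"
  using x_delta_has_derivative DERIV_imp_deriv by blast

lemma deriv_y_delta: "deriv (y_delta a \<delta>) = vel_y \<delta>"
  using y_delta_has_derivative DERIV_imp_deriv by blast

lemma vel_x_has_derivative:
  "(vel_x \<delta> has_real_derivative a * inverse (cosh (a * s)) * vel_y \<delta> s) (at s)"
  unfolding vel_x_def[abs_def] vel_y_def
  by (rule derivative_eq_intros tanh_has_derivative inverse_cosh_has_derivative refl)+
    (simp add: algebra_simps power2_eq_square)

lemma vel_y_has_derivative:
  "(vel_y \<delta> has_real_derivative - a * inverse (cosh (a * s)) * vel_x \<delta> s) (at s)"
  unfolding vel_y_def[abs_def] vel_x_def
  by (rule derivative_eq_intros tanh_has_derivative inverse_cosh_has_derivative refl)+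
    (simp add: algebra_simps power2_eq_square)

text \<open>A rotation preserves length, and the unrotated velocity (tanh, sech) is a unit
  vector.\<close>

lemma vel_square: "vel_x \<delta> s ^ 2 + vel_y \<delta> s ^ 2 = 1"
proof -
  have "vel_x \<delta> s ^ 2 + vel_y \<delta> s ^ 2 =
    (cos \<delta> ^ 2 + sin \<delta> ^ 2) * (tanh (a * s) ^ 2 + inverse (cosh (a * s)) ^ 2)"
    unfolding vel_x_def vel_y_def by algebra
  then show ?thesis by (simp only: tanh_square_plus_sech_square sin_cos_squared_add2 mult_1)
qed

text \<open>Undoing the rotation recovers the second coordinate of the unrotated velocity. This
  makes the acceleration factor linear in the rotated velocity.\<close>

lemma sech_eq_vel: "inverse (cosh (a * s)) = sin \<delta> * vel_x \<delta> s + cos \<delta> * vel_y \<delta> s"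
proof -
  have "sin \<delta> * vel_x \<delta> s + cos \<delta> * vel_y \<delta> s =
    (cos \<delta> ^ 2 + sin \<delta> ^ 2) * inverse (cosh (a * s))"
    unfolding vel_x_def vel_y_def by algebra
  then show ?thesis by simp
qed

text \<open>By the choice of \<open>s_zero\<close>, sinh takes the value cot \<delta> there. Since
  sinh is increasing, the sign of \<open>vel_y\<close> can be read off.\<close>

lemma vel_y_eq_sinh:
  assumes "0 < sin \<delta>"
  shows "vel_y \<delta> s = sin \<delta> * (sinh (a * s_zero a \<delta>) - sinh (a * s)) / cosh (a * s)"
proof -
  have "sinh (a * s_zero a \<delta>) = cos \<delta> / sin \<delta>"
    using a_pos by (simp add: s_zero_def cot_def)
  then show ?thesis
    using assms by (simp add: vel_y_def tanh_def field_simps)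
qed

lemma curve_alpha_delta: "curve {0..} (\<lambda>t. alpha_delta a \<delta> (b + c * t))"
proof -
  have "x_delta a \<delta> = (\<lambda>s. cos \<delta> * x_alpha a s + sin \<delta> * y_alpha a s)"
    "y_delta a \<delta> = (\<lambda>s. - sin \<delta> * x_alpha a s + cos \<delta> * y_alpha a s)"
    by (auto simp: x_delta_def y_delta_def)
  then have "alpha_alg (x_delta a \<delta>)" "alpha_alg (y_delta a \<delta>)"
    by (auto simp only: intro!: alpha_alg.add alpha_alg.mult alpha_alg.const
        alpha_alg.x_alpha alpha_alg.y_alpha)
  then show ?thesis
    unfolding curve_def alpha_delta_def
    by (intro conjI smooth_on_alpha_alg at_within_atLeast_neq_bot)
      \<comment> \<open>The point -1 witnesses that something lies strictly below the endpoint 0, as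
        the formula for the interior of the ray demands.\<close>
      (auto simp: interior_Ici[of "-1"])
qed

lemma alpha_delta_has_vector_derivative:
  "((\<lambda>t. alpha_delta a \<delta> (b + c * t)) has_vector_derivative
     (c * vel_x \<delta> (b + c * t), c * vel_y \<delta> (b + c * t))) (at t within J)"
  unfolding alpha_delta_def
  by (rule has_vector_derivative_affine_pair[OF x_delta_has_derivative y_delta_has_derivative])

lemma D_on_alpha_delta:
  assumes "0 \<le> t"
  shows "D_on {0..} (\<lambda>t. alpha_delta a \<delta> (b + c * t)) t =
    (c * vel_x \<delta> (b + c * t), c * vel_y \<delta> (b + c * t))"
  using assms
  by (intro D_on_eqI[OF alpha_delta_has_vector_derivative] at_within_atLeast_neq_bot)

lemma norm_velocity: "norm (c * vel_x \<delta> s, c * vel_y \<delta> s) = \<bar>c\<bar>"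
proof -
  have "(c * vel_x \<delta> s)\<^sup>2 + (c * vel_y \<delta> s)\<^sup>2 = c\<^sup>2"
    using vel_square[of \<delta> s] by algebra
  then show ?thesis by (simp add: norm_Pair)
qed

lemma velocity_nonzero:
  assumes "c \<noteq> 0"
  shows "(c * vel_x \<delta> s, c * vel_y \<delta> s) \<noteq> 0"
  using norm_velocity[of c \<delta> s] assms by (metis abs_eq_0 norm_zero)

text \<open>Each differentiation contributes one factor \<open>c\<close>. The result is orthogonal
  to the velocity, as constant speed requires.\<close>

lemma D_on_D_on_alpha_delta:
  fixes b c t \<delta> :: real
  assumes "0 \<le> t"
  defines "s \<equiv> b + c * t"
  shows "D_on {0..} (D_on {0..} (\<lambda>t. alpha_delta a \<delta> (b + c * t))) t =
    (c\<^sup>2 * a * inverse (cosh (a * s))) *\<^sub>R (vel_y \<delta> s, - vel_x \<delta> s)"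
proof -
  have "((\<lambda>t. c *\<^sub>R (vel_x \<delta> (b + c * t), vel_y \<delta> (b + c * t))) has_vector_derivative
      c *\<^sub>R (c * (a * inverse (cosh (a * s)) * vel_y \<delta> s),
        c * (- a * inverse (cosh (a * s)) * vel_x \<delta> s))) (at t within {0..})"
    unfolding s_def
    by (intro bounded_linear.has_vector_derivative[OF bounded_linear_scaleR_right]
        has_vector_derivative_affine_pair[OF vel_x_has_derivative vel_y_has_derivative])
  \<comment> \<open>The closed form of the first derivative is known only on the ray, so the
    derivative is transferred within it.\<close>
  then have "(D_on {0..} (\<lambda>t. alpha_delta a \<delta> (b + c * t)) has_vector_derivative
      c *\<^sub>R (c * (a * inverse (cosh (a * s)) * vel_y \<delta> s),
        c * (- a * inverse (cosh (a * s)) * vel_x \<delta> s))) (at t within {0..})"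
    by (rule has_vector_derivative_transform[rotated 2])
      (use assms(1) in \<open>auto simp: D_on_alpha_delta\<close>)
  from D_on_eqI[OF this at_within_atLeast_neq_bot[OF assms(1)]] show ?thesis
    by (simp add: power2_eq_square mult_ac)
qed

section \<open>The equation of motion for both directions\<close>

text \<open>The ramps \<open>\<gamma>\<^sub>\<delta>\<close> and \<open>\<gamma>~\<^sub>\<delta>\<close> are the cases \<open>\<sigma> = -1\<close> and \<open>\<sigma> = 1\<close>.\<close>

lemma ramp_solution_alpha_delta:
  fixes \<delta> v m g \<sigma> :: real
  assumes \<delta>: "0 < \<delta>" "\<delta> < pi / 4" and pos: "0 < v" "0 < m" "0 < g"
    and a: "a = g / (v\<^sup>2 * sin \<delta>)" and \<sigma>: "\<sigma> \<in> {-1, 1}"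
  defines "s0 \<equiv> s_zero a \<delta>"
  shows "ramp_solution m (tan \<delta>) {0..} (\<lambda>s. alpha_delta a \<delta> (s0 + \<sigma> * s))
    (\<lambda>s. \<sigma> *\<^sub>R (- vel_y \<delta> (s0 + \<sigma> * s), vel_x \<delta> (s0 + \<sigma> * s))) (\<lambda>t. (0, - m * g))
    {0..} (\<lambda>t. v * t) (\<lambda>t. alpha_delta a \<delta> (s0 + (\<sigma> * v) * t))
    (\<lambda>t. - \<sigma> * m * g * cot \<delta> * vel_y \<delta> (s0 + (\<sigma> * v) * t))"
proof -
  have sin_cos: "0 < sin \<delta>" "0 < cos \<delta>"
    using \<delta> by (auto intro!: sin_gt_zero cos_gt_zero)
  have tan: "0 < tan \<delta>" "tan \<delta> < 1"
    using \<delta> tan_monotone[of \<delta> "pi / 4"] by (auto intro!: tan_gt_zero simp: tan_45)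
  have ramp: "ramp_with_force {0..} (\<lambda>s. alpha_delta a \<delta> (s0 + \<sigma> * s))
      (\<lambda>s. \<sigma> *\<^sub>R (- vel_y \<delta> (s0 + \<sigma> * s), vel_x \<delta> (s0 + \<sigma> * s))) (\<lambda>t. (0, - m * g))"
  proof -
    have "norm (\<sigma> *\<^sub>R (- vel_y \<delta> s, vel_x \<delta> s)) = 1" for s
      using \<sigma> vel_square[of \<delta> s] by (auto simp: norm_Pair add.commute)
    moreover have "(\<sigma> * vel_x \<delta> s, \<sigma> * vel_y \<delta> s) \<noteq> 0" for s
      using \<sigma> by (intro velocity_nonzero) auto
    ultimately show ?thesis
      unfolding ramp_with_force_def ramp_def regular_curve_def
      by (auto simp: D_on_alpha_delta curve_alpha_delta at_within_atLeast_neq_bot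
          intro!: smooth_on_const)
  qed
  have nonneg: "0 \<le> - \<sigma> * m * g * cot \<delta> * vel_y \<delta> (s0 + \<sigma> * v * t)" if "0 \<le> t" for t
  proof -
    \<comment> \<open>The displacement from \<open>s0\<close> is \<open>\<sigma> * v * t\<close>,
      which has the sign of \<sigma>; monotonicity of sinh gives the difference the same
      sign.\<close>
    have "0 \<le> \<sigma> * (sinh (a * (s0 + \<sigma> * v * t)) - sinh (a * s0))"
      using \<sigma> pos that a_pos by auto
    then have "0 \<le> (m * g * cos \<delta> / cosh (a * (s0 + \<sigma> * v * t)))
        * (\<sigma> * (sinh (a * (s0 + \<sigma> * v * t)) - sinh (a * s0)))"
      using pos sin_cos by (intro mult_nonneg_nonneg[OF divide_nonneg_nonneg]) auto
    also have "\<dots> = - \<sigma> * m * g * cot \<delta> * vel_y \<delta> (s0 + \<sigma> * v * t)"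
      using sin_cos by (simp add: vel_y_eq_sinh s0_def cot_def field_simps)
    finally show ?thesis .
  qed
  have nonzero: "(\<sigma> * v * vel_x \<delta> s, \<sigma> * v * vel_y \<delta> s) \<noteq> 0" for s
    using \<sigma> pos by (intro velocity_nonzero) auto
  \<comment> \<open>Treating the velocity as bare numbers \<open>X\<close>, \<open>Y\<close> turns
    the equation into polynomial algebra.\<close>
  have motion: "(0, - m * g) + (- \<sigma> * m * g * cot \<delta> * Y) *\<^sub>R (\<sigma> *\<^sub>R (- Y, X))
      - (tan \<delta> * (- \<sigma> * m * g * cot \<delta> * Y)) *\<^sub>R
          ((\<sigma> * v * X, \<sigma> * v * Y) /\<^sub>R norm (\<sigma> * v * X, \<sigma> * v * Y))
      = m *\<^sub>R ((\<sigma> * v)\<^sup>2 * a * inverse (cosh (a * s))) *\<^sub>R (Y, - X)"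
    if X: "X = vel_x \<delta> s" and Y: "Y = vel_y \<delta> s" for s X Y
  proof -
    have norm: "norm (\<sigma> * v * X, \<sigma> * v * Y) = v"
      using norm_velocity[of "\<sigma> * v" \<delta> s] \<sigma> pos X Y by (auto simp: abs_mult)
    have sech: "inverse (cosh (a * s)) = sin \<delta> * X + cos \<delta> * Y"
      and unit: "X\<^sup>2 + Y\<^sup>2 = 1"
      using sech_eq_vel vel_square X Y by auto
    have \<sigma>2: "\<sigma>\<^sup>2 = 1" using \<sigma> by auto
    have tan_cot: "tan \<delta> * cot \<delta> = 1" and cot_sin: "cot \<delta> * sin \<delta> = cos \<delta>"
      using sin_cos by (auto simp: tan_def cot_def)
    have va: "v\<^sup>2 * a * sin \<delta> = g"
      using a pos sin_cos by simp
    have va_cos: "v\<^sup>2 * a * cos \<delta> = g * cot \<delta>"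
      unfolding cot_sin[symmetric] va[symmetric] by (simp only: mult_ac)
    have direction: "(\<sigma> * v * X, \<sigma> * v * Y) /\<^sub>R v = \<sigma> *\<^sub>R (X, Y)"
      using pos by simp
    \<comment> \<open>Both \<open>lam\<close> and the normal carry \<sigma>, as do
      \<open>lam\<close> and the direction of motion in the friction term; each pair cancels by
      \<sigma>^2 = 1. In \<open>friction\<close>, cot \<delta> also cancels against the coefficient
      tan \<delta>.\<close>
    have normal: "- \<sigma> * m * g * cot \<delta> * Y * \<sigma> = - m * g * cot \<delta> * Y"
      using \<sigma>2 by algebra
    have friction: "tan \<delta> * (- \<sigma> * m * g * cot \<delta> * Y) * \<sigma> = - m * g * Y"
      using \<sigma>2 tan_cot by algebra
    have acceleration:
      "m * ((\<sigma> * v)\<^sup>2 * a * inverse (cosh (a * s))) = m * g * X + m * g * cot \<delta> * Y"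
      unfolding sech using \<sigma>2 va va_cos by algebra
    \<comment> \<open>Multiplying the weight by X^2 + Y^2 makes every term quadratic in
      \<open>X\<close>, \<open>Y\<close>: the Y^2 part cancels the vertical friction, and the rest
      matches the acceleration coefficientwise.\<close>
    have "- m * g = - m * g * X * X - m * g * Y * Y"
      using unit by algebra
    then have gravity: "(0 :: real, - m * g) = (0, - m * g * X * X - m * g * Y * Y)"
      by (simp only:)
    show ?thesis
      unfolding norm direction scaleR_scaleR normal friction acceleration gravity
      by (simp add: algebra_simps)
  qed
  show ?thesis
    unfolding ramp_solution_def
  proof (intro conjI ballI)
    fix t :: real assume "t \<in> {0..}"
    then have t: "0 \<le> t" by simp
    show "v * t \<in> {0..}" using t pos by simp
    show "0 \<le> - \<sigma> * m * g * cot \<delta> * vel_y \<delta> (s0 + \<sigma> * v * t)"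
      by (rule nonneg[OF t])
    show "D_on {0..} (\<lambda>t. alpha_delta a \<delta> (s0 + \<sigma> * v * t)) t \<noteq> 0"
      unfolding D_on_alpha_delta[OF t] by (rule nonzero)
    show "(0, - m * g)
        + (- \<sigma> * m * g * cot \<delta> * vel_y \<delta> (s0 + \<sigma> * v * t)) *\<^sub>R
            \<sigma> *\<^sub>R (- vel_y \<delta> (s0 + \<sigma> * (v * t)), vel_x \<delta> (s0 + \<sigma> * (v * t)))
        - (tan \<delta> * (- \<sigma> * m * g * cot \<delta> * vel_y \<delta> (s0 + \<sigma> * v * t))) *\<^sub>R
            (D_on {0..} (\<lambda>t. alpha_delta a \<delta> (s0 + \<sigma> * v * t)) t /\<^sub>R
              norm (D_on {0..} (\<lambda>t. alpha_delta a \<delta> (s0 + \<sigma> * v * t)) t))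
        = m *\<^sub>R D_on {0..} (D_on {0..} (\<lambda>t. alpha_delta a \<delta> (s0 + \<sigma> * v * t))) t"
      \<comment> \<open>The normal is evaluated at \<open>h t\<close>, hence at
        \<open>\<sigma> * (v * t)\<close>, while the motion has \<open>(\<sigma> * v) * t\<close>;
        reassociating makes the two arguments identical.\<close>
      unfolding D_on_D_on_alpha_delta[OF t] D_on_alpha_delta[OF t] mult.assoc[symmetric, of \<sigma> v t]
      by (rule motion[OF refl refl])
  qed (use pos tan ramp curve_alpha_delta[of \<delta> s0 "\<sigma> * v"] in \<open>simp_all add: mult.assoc\<close>)
qed

end

section \<open>Specialization to the two ramps\<close>

theorem theorem3p6:
  fixes \<delta> v m g \<mu> a :: real and F :: "real \<Rightarrow> real \<times> real"
  assumes "0 < \<delta>" and "\<delta> < pi / 4" and "0 < v" and "0 < m"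
    and "g = 9.81" and "\<mu> = tan \<delta>" and "a = g / (v\<^sup>2 * sin \<delta>)"
    and "F = (\<lambda>t. (0, - m * g))"
  shows "ramp_solution m \<mu> {0..} (gamma_delta a \<delta>) (n_delta a \<delta>) F
           {0..} (\<lambda>t. v * t) (\<lambda>t. gamma_delta a \<delta> (v * t))
           (\<lambda>t. m * g * cot \<delta> * deriv (y_delta a \<delta>) (s_zero a \<delta> - v * t)) \<and>
         ramp_solution m \<mu> {0..} (gamma_tilde a \<delta>) (n_tilde a \<delta>) F
           {0..} (\<lambda>t. v * t) (\<lambda>t. gamma_tilde a \<delta> (v * t))
           (\<lambda>t. - m * g * cot \<delta> * deriv (y_delta a \<delta>) (s_zero a \<delta> + v * t)) \<and>
         (\<forall>t\<ge>0. norm (D_on {0..} (\<lambda>t. gamma_delta a \<delta> (v * t)) t) = v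
             \<and> norm (D_on {0..} (\<lambda>t. gamma_tilde a \<delta> (v * t)) t) = v)"
proof -
  have sin_pos: "0 < sin \<delta>"
    using assms(1,2) by (intro sin_gt_zero) auto
  then have a_pos: "0 < a" and g_pos: "0 < g"
    using assms(3,5,7) by auto
  note sol = ramp_solution_alpha_delta[OF a_pos assms(1-4) g_pos assms(7)]
  have norm: "norm (D_on {0..} (\<lambda>t. alpha_delta a \<delta> (s_zero a \<delta> + c * t)) t) = \<bar>c\<bar>"
    if "0 \<le> t" for c t
    using that a_pos by (simp add: D_on_alpha_delta norm_velocity)
  \<comment> \<open>The factors \<open>- 1\<close> and \<open>1\<close> are kept explicit so that
    these forms are literal instances of \<sigma> in \<open>sol\<close>; the same holds for
    \<open>n\<close>.\<close>
  have gamma: "gamma_delta a \<delta> = (\<lambda>s. alpha_delta a \<delta> (s_zero a \<delta> + (- 1) * s))"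
    "gamma_tilde a \<delta> = (\<lambda>s. alpha_delta a \<delta> (s_zero a \<delta> + 1 * s))"
    by (simp_all add: gamma_delta_def gamma_tilde_def fun_eq_iff)
  have n: "n_delta a \<delta> = (\<lambda>s. (- 1) *\<^sub>R (- deriv (y_delta a \<delta>) (s_zero a \<delta> + (- 1) * s),
        deriv (x_delta a \<delta>) (s_zero a \<delta> + (- 1) * s)))"
    "n_tilde a \<delta> = (\<lambda>s. 1 *\<^sub>R (- deriv (y_delta a \<delta>) (s_zero a \<delta> + 1 * s),
        deriv (x_delta a \<delta>) (s_zero a \<delta> + 1 * s)))"
    by (simp_all add: n_delta_def n_tilde_def fun_eq_iff)
  have "ramp_solution m \<mu> {0..} (gamma_delta a \<delta>) (n_delta a \<delta>) F
      {0..} (\<lambda>t. v * t) (\<lambda>t. gamma_delta a \<delta> (v * t))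
      (\<lambda>t. m * g * cot \<delta> * deriv (y_delta a \<delta>) (s_zero a \<delta> - v * t))"
    using sol[of "- 1"] unfolding gamma n assms(6,8) deriv_x_delta[OF a_pos] deriv_y_delta[OF a_pos]
    by simp
  moreover have "ramp_solution m \<mu> {0..} (gamma_tilde a \<delta>) (n_tilde a \<delta>) F
      {0..} (\<lambda>t. v * t) (\<lambda>t. gamma_tilde a \<delta> (v * t))
      (\<lambda>t. - m * g * cot \<delta> * deriv (y_delta a \<delta>) (s_zero a \<delta> + v * t))"
    using sol[of 1] unfolding gamma n assms(6,8) deriv_x_delta[OF a_pos] deriv_y_delta[OF a_pos]
    by simp
  moreover have "norm (D_on {0..} (\<lambda>t. gamma_delta a \<delta> (v * t)) t) = v"
    "norm (D_on {0..} (\<lambda>t. gamma_tilde a \<delta> (v * t)) t) = v" if "0 \<le> t" for t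
    using norm[OF that, of "- v"] norm[OF that, of v] assms(3) unfolding gamma by simp_all
  ultimately show ?thesis by blast
qed

end
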